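(* Let $\xi:\mathsf Y\to\mathsf X$ be a homeomorphism between topological spaces $\mathsf Y$ and $\mathsf X$, equipped with their Borel $\sigma$-fields. Let $\Phi=\{\phi_t\}_{t\in\mathbb N}$ be a time-homogeneous Markov chain with state space $\mathsf Y$, and define $\Theta=\{\xi(\phi_t)\}_{t\in\mathbb N}$. Then: (i) $\Theta$ is a time-homogeneous Markov chain with state space $\mathsf X$; (ii) if $\Theta$ is irreducible (resp. aperiodic, a T-chain), then $\Phi$ is irreducible (resp. aperiodic, a T-chain).
   Context: For a transition kernel $P$ on $(\mathsf X,\mathcal B(\mathsf X))$ with iterates $P^k$: $P$ is *irreducible* if there is a nontrivial nonnegative (irreducibility) measure $\varphi$ on $\mathcal B(\mathsf X)$ such that $\varphi(\mathsf A)>0$ implies that for every $x$ there is $k\ge1$ with $P^k(x,\mathsf A)>0$. The *period* of an irreducible $P$ is the largest $k\ge1$ for which there are disjoint Borel sets $\mathsf D_1,\dots,\mathsf D_k$ with $\varphi((\mathsf D_1\cup\dots\cup\mathsf D_k)^c)=0$ for every irreducibility measure $\varphi$ of $P$ and $P(x,\mathsf D_{i+1})=1$ for $x\in\mathsf D_i$ (indices mod $k$); $P$ is *aperiodic* if it is irreducible with period $1$. $P$ is a *T-kernel* if there are a probability $b$ on $\mathbb N$ and a substochastic kernel $T$ on $\mathsf X$ such that $T(\cdot,\mathsf A)$ is lower semicontinuous for every Borel $\mathsf A$, $T(x,\mathsf X)>0$ for all $x$, and $\sum_{k\ge0}b(k)P^k(x,\mathsf A)\ge T(x,\mathsf A)$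 for all $x,\mathsf A$. A Markov chain is irreducible, aperiodic, a T-chain when its transition kernel is irreducible, aperiodic, a T-kernel, respectively. *)

theory Defs
  imports "HOL-Probability.Probability"
begin

definition transition_kernel :: "('s::topological_space \<Rightarrow> 's measure) \<Rightarrow> bool" where
  "transition_kernel P \<longleftrightarrow> P \<in> borel \<rightarrow>\<^sub>M prob_algebra borel"

definition substochastic_kernel :: "('s::topological_space \<Rightarrow> 's measure) \<Rightarrow> bool" where
  "substochastic_kernel T \<longleftrightarrow> T \<in> borel \<rightarrow>\<^sub>M subprob_algebra borel"

primrec kernel_pow :: "('s::topological_space \<Rightarrow> 's measure) \<Rightarrow> nat \<Rightarrow> 's \<Rightarrow> 's measure" where
  "kernel_pow P 0 = (\<lambda>x. return borel x)"
| "kernel_pow P (Suc k) = (\<lambda>x. P x \<bind> kernel_pow P k)"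

definition irreducibility_measure ::
    "('s::topological_space \<Rightarrow> 's measure) \<Rightarrow> 's measure \<Rightarrow> bool" where
  "irreducibility_measure P \<phi> \<longleftrightarrow>
     sets \<phi> = sets borel \<and> emeasure \<phi> UNIV > 0 \<and>
     (\<forall>A\<in>sets borel. emeasure \<phi> A > 0 \<longrightarrow> (\<forall>x. \<exists>k\<ge>1. emeasure (kernel_pow P k x) A > 0))"

definition irreducible_kernel :: "('s::topological_space \<Rightarrow> 's measure) \<Rightarrow> bool" where
  "irreducible_kernel P \<longleftrightarrow> (\<exists>\<phi>. irreducibility_measure P \<phi>)"

(* The sets D_1, ..., D_k are indexed by 0, ..., k - 1. *)
definition has_cycle :: "('s::topological_space \<Rightarrow> 's measure) \<Rightarrow> nat \<Rightarrow> bool" where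
  "has_cycle P k \<longleftrightarrow>
     (\<exists>D :: nat \<Rightarrow> 's set.
        (\<forall>i<k. D i \<in> sets borel) \<and> disjoint_family_on D {..<k} \<and>
        (\<forall>\<phi>. irreducibility_measure P \<phi> \<longrightarrow> emeasure \<phi> (- (\<Union>i<k. D i)) = 0) \<and>
        (\<forall>i<k. \<forall>x\<in>D i. emeasure (P x) (D (Suc i mod k)) = 1))"

(* A relation rather than a function, so that no value is assigned when there is no largest k. *)
definition is_period :: "('s::topological_space \<Rightarrow> 's measure) \<Rightarrow> nat \<Rightarrow> bool" where
  "is_period P d \<longleftrightarrow> d \<ge> 1 \<and> has_cycle P d \<and> (\<forall>k\<ge>1. has_cycle P k \<longrightarrow> k \<le> d)"

definition aperiodic_kernel :: "('s::topological_space \<Rightarrow> 's measure) \<Rightarrow> bool" where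
  "aperiodic_kernel P \<longleftrightarrow> irreducible_kernel P \<and> is_period P 1"

definition lower_semicontinuous :: "('s::topological_space \<Rightarrow> 'v::linorder) \<Rightarrow> bool" where
  "lower_semicontinuous f \<longleftrightarrow> (\<forall>c. open {x. c < f x})"

definition T_kernel :: "('s::topological_space \<Rightarrow> 's measure) \<Rightarrow> bool" where
  "T_kernel P \<longleftrightarrow>
     (\<exists>(b :: nat pmf) T. substochastic_kernel T \<and>
        (\<forall>A\<in>sets borel. lower_semicontinuous (\<lambda>x. emeasure (T x) A)) \<and>
        (\<forall>x. emeasure (T x) UNIV > 0) \<and>
        (\<forall>x. \<forall>A\<in>sets borel.
           (\<Sum>k. ennreal (pmf b k) * emeasure (kernel_pow P k x) A) \<ge> emeasure (T x) A))"

(* The sigma-field generated by X 0, ..., X t. *)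
definition history ::
    "'a measure \<Rightarrow> (nat \<Rightarrow> 'a \<Rightarrow> 's::topological_space) \<Rightarrow> nat \<Rightarrow> 'a measure" where
  "history M X t = sigma (space M) {X s -` A \<inter> space M | s A. s \<le> t \<and> A \<in> sets borel}"

(* X is a time-homogeneous Markov chain on the probability space M with transition kernel P,
   started from an arbitrary initial law:
   P(X_{t+1} in A | X_0, ..., X_t) = P(X_t, A) almost surely. The kernel is part of the data:
   the law of X determines it only up to null sets, whereas irreducibility, the period and
   the T-property constrain it at every point of the state space. *)
definition markov_chain ::
    "'a measure \<Rightarrow> (nat \<Rightarrow> 'a \<Rightarrow> 's::topological_space) \<Rightarrow> ('s \<Rightarrow> 's measure) \<Rightarrow> bool" where
  "markov_chain M X P \<longleftrightarrow>
     prob_space M \<and> transition_kernel P \<and> (\<forall>t. X t \<in> M \<rightarrow>\<^sub>M borel) \<and>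
     (\<forall>t. \<forall>A\<in>sets borel. AE \<omega> in M.
        real_cond_exp M (history M X t) (\<lambda>\<omega>'. indicator A (X (Suc t) \<omega>')) \<omega>
          = measure (P (X t \<omega>)) A)"

(* (x, A) |-> P(xi^{-1}(x), xi^{-1}(A)), for a bijection xi *)
definition image_kernel ::
    "('r::topological_space \<Rightarrow> 's::topological_space) \<Rightarrow> ('r \<Rightarrow> 'r measure) \<Rightarrow> 's \<Rightarrow> 's measure" where
  "image_kernel \<xi> P x = distr (P (inv \<xi> x)) borel \<xi>"

end

theory Submission
  imports Defs
begin

text \<open>
  A homeomorphism \<open>f : S \<rightarrow> S'\<close> with inverse \<open>g\<close> is a Borel isomorphism, so the image kernel
  \<open>P\<^sub>f(x, A) = P(g x, f\<inverse> A)\<close> is an isomorphic copy of \<open>P\<close>. Its iterates are the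
  images of the iterates of \<open>P\<close> (\<open>kernel_pow_image_kernel\<close>), and transporting back along \<open>g\<close>
  recovers \<open>P\<close> (\<open>image_kernel_inverse\<close>). Hence it suffices to show that each property passes
  from \<open>P\<close> to \<open>P\<^sub>f\<close> for an arbitrary homeomorphism; the converse is the same statement for \<open>g\<close>.
  Irreducibility measures are pushed forward along \<open>f\<close>; a cycle \<open>D\<^sub>i\<close> of \<open>P\<close> becomes
  the cycle \<open>g\<inverse> D\<^sub>i\<close>, so that \<open>P\<close> and \<open>P\<^sub>f\<close> have cycles of the same lengths; a continuous
  component \<open>T\<close> becomes \<open>T\<^sub>f\<close>, which is lower semicontinuous because \<open>g\<close> is continuous.

  For the chain itself, \<open>f \<circ> X\<close> generates the same history as \<open>X\<close>, and the event
  \<open>f (X\<^sub>t\<^sub>+\<^sub>1) \<in> A\<close> is \<open>X\<^sub>t\<^sub>+\<^sub>1 \<in> f\<inverse> A\<close>, so the Markov property of \<open>f \<circ> X\<close> with kernel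
  \<open>P\<^sub>f\<close> is that of \<open>X\<close> with kernel \<open>P\<close>. If \<open>f \<circ> X\<close> is described by some other kernel \<open>Q\<close>, then \<open>Q\<^sub>g\<close>
  is a kernel for \<open>X\<close> that inherits the properties of \<open>Q\<close>.
\<close>

section \<open>Image kernels under a homeomorphism\<close>

lemma homeomorphism_UNIV_inverse:
  assumes "homeomorphism UNIV UNIV f g"
  shows "g (f y) = y" "f (g x) = x" "inv f = g"
proof -
  show gf: "g (f y) = y" and fg: "f (g x) = x" for x y
    using assms by (auto simp: homeomorphism_def)
  show "inv f = g"
    by (rule inv_equality) (simp_all add: gf fg)
qed

lemma homeomorphism_UNIV_measurable:
  assumes "homeomorphism UNIV UNIV f g"
  shows "f \<in> borel \<rightarrow>\<^sub>M borel" "g \<in> borel \<rightarrow>\<^sub>M borel"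
  using assms by (auto simp: homeomorphism_def intro: borel_measurable_continuous_onI)

lemma image_kernel_apply:
  assumes "homeomorphism UNIV UNIV f g"
  shows "image_kernel f P x = distr (P (g x)) borel f"
  using homeomorphism_UNIV_inverse(3)[OF assms] by (simp add: image_kernel_def)

text \<open>
  The condition on the \<open>\<sigma>\<close>-field is needed because \<open>distr\<close> fixes it: the left-hand side always
  consists of Borel measures.
\<close>

lemma image_kernel_inverse:
  assumes h: "homeomorphism UNIV UNIV f g" and "\<And>y. sets (P y) = sets borel"
  shows "image_kernel g (image_kernel f P) = P"
proof
  fix y
  note [measurable] = homeomorphism_UNIV_measurable[OF h]
  have s: "sets (P y) = sets borel" by fact
  then have [measurable]: "f \<in> P y \<rightarrow>\<^sub>M borel"
    by (simp cong: measurable_cong_sets)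
  have "image_kernel g (image_kernel f P) y = distr (distr (P y) borel f) borel g"
    using h by (simp add: image_kernel_apply image_kernel_apply[OF homeomorphism_symD[OF h]]
        homeomorphism_UNIV_inverse[OF h])
  also have "\<dots> = distr (P y) borel (\<lambda>y. y)"
    by (simp add: distr_distr comp_def homeomorphism_UNIV_inverse[OF h])
  also have "\<dots> = P y"
    using s by (intro distr_id2) simp
  finally show "image_kernel g (image_kernel f P) y = P y" .
qed

lemma sets_transition_kernel:
  assumes "transition_kernel P"
  shows "sets (P y) = sets borel"
  using measurable_space[OF assms[unfolded transition_kernel_def], of y]
  by (simp add: space_prob_algebra)

lemma transition_kernel_image_kernel:
  assumes h: "homeomorphism UNIV UNIV f g" and "transition_kernel P"
  shows "transition_kernel (image_kernel f P)"
proof -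
  note [measurable] = homeomorphism_UNIV_measurable[OF h]
  have [measurable]: "P \<in> borel \<rightarrow>\<^sub>M prob_algebra borel"
    using assms(2) by (simp add: transition_kernel_def)
  show ?thesis
    unfolding transition_kernel_def image_kernel_apply[OF h, abs_def] by measurable
qed

lemma substochastic_kernel_image_kernel:
  assumes h: "homeomorphism UNIV UNIV f g" and "substochastic_kernel T"
  shows "substochastic_kernel (image_kernel f T)"
proof -
  note [measurable] = homeomorphism_UNIV_measurable[OF h]
  have [measurable]: "T \<in> borel \<rightarrow>\<^sub>M subprob_algebra borel"
    using assms(2) by (simp add: substochastic_kernel_def)
  show ?thesis
    unfolding substochastic_kernel_def image_kernel_apply[OF h, abs_def]
    by (rule measurable_compose[OF _ measurable_distr]) measurable
qed

section \<open>Iterates of image kernels\<close>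

lemma transition_kernel_imp_subprob:
  assumes "transition_kernel P"
  shows "P \<in> borel \<rightarrow>\<^sub>M subprob_algebra borel"
  using assms by (auto simp: transition_kernel_def intro: measurable_prob_algebraD)

lemma measurable_kernel_pow:
  assumes "transition_kernel P"
  shows "kernel_pow P k \<in> borel \<rightarrow>\<^sub>M subprob_algebra borel"
proof (induction k)
  case 0
  show ?case by (simp add: return_measurable)
next
  case (Suc k)
  then show ?case
    using measurable_bind2[OF transition_kernel_imp_subprob[OF assms]] by simp
qed

lemma sets_kernel_pow:
  assumes "transition_kernel P"
  shows "sets (kernel_pow P k y) = sets borel"
  using measurable_space[OF measurable_kernel_pow[OF assms], of y k]
  by (simp add: space_subprob_algebra)

lemma kernel_pow_image_kernel:
  assumes h: "homeomorphism UNIV UNIV f g" and P: "transition_kernel P"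
  shows "kernel_pow (image_kernel f P) k = image_kernel f (kernel_pow P k)"
proof (induction k)
  case 0
  note [measurable] = homeomorphism_UNIV_measurable[OF h]
  show ?case
    by (rule ext)
      (simp add: image_kernel_apply[OF h] distr_return homeomorphism_UNIV_inverse[OF h])
next
  case (Suc k)
  show ?case
  proof
    fix x
    note [measurable] = homeomorphism_UNIV_measurable[OF h] measurable_kernel_pow[OF P]
      measurable_kernel_pow[OF transition_kernel_image_kernel[OF h P]]
    have s: "sets (P (g x)) = sets borel"
      by (rule sets_transition_kernel[OF P])
    then have ne: "space (P (g x)) \<noteq> {}"
      by (simp add: sets_eq_imp_space_eq)
    have f: "f \<in> P (g x) \<rightarrow>\<^sub>M borel"
      using s by (simp cong: measurable_cong_sets)
    have k: "kernel_pow P k \<in> P (g x) \<rightarrow>\<^sub>M subprob_algebra borel"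
      using s by (simp cong: measurable_cong_sets)
    have "kernel_pow (image_kernel f P) (Suc k) x
        = distr (P (g x)) borel f \<bind> kernel_pow (image_kernel f P) k"
      by (simp add: image_kernel_apply[OF h])
    also have "\<dots> = P (g x) \<bind> (\<lambda>y. kernel_pow (image_kernel f P) k (f y))"
      by (rule bind_distr[OF f _ ne, where K = borel]) simp
    also have "\<dots> = P (g x) \<bind> (\<lambda>y. distr (kernel_pow P k y) borel f)"
      by (simp add: Suc.IH image_kernel_apply[OF h] homeomorphism_UNIV_inverse[OF h])
    also have "\<dots> = distr (P (g x) \<bind> kernel_pow P k) borel f"
      by (rule distr_bind[OF k ne, symmetric]) simp
    also have "\<dots> = image_kernel f (kernel_pow P (Suc k)) x"
      by (simp add: image_kernel_apply[OF h])
    finally show "kernel_pow (image_kernel f P) (Suc k) x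
        = image_kernel f (kernel_pow P (Suc k)) x" .
  qed
qed

lemma emeasure_image_kernel:
  assumes h: "homeomorphism UNIV UNIV f g" and "sets (P (g x)) = sets borel" and "A \<in> sets borel"
  shows "emeasure (image_kernel f P x) A = emeasure (P (g x)) (f -` A)"
proof -
  have "f \<in> P (g x) \<rightarrow>\<^sub>M borel"
    using homeomorphism_UNIV_measurable(1)[OF h] assms(2) by (simp cong: measurable_cong_sets)
  moreover have "space (P (g x)) = UNIV"
    using assms(2) by (simp add: sets_eq_imp_space_eq)
  ultimately show ?thesis
    using assms(3) by (simp add: image_kernel_apply[OF h] emeasure_distr)
qed

lemma vimage_borel:
  assumes "homeomorphism UNIV UNIV f g" and "A \<in> sets borel"
  shows "f -` A \<in> sets borel"
  using measurable_sets[OF homeomorphism_UNIV_measurable(1)[OF assms(1)] assms(2)] by simp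

lemma emeasure_distr_homeomorphism:
  assumes h: "homeomorphism UNIV UNIV f g" and "sets \<mu> = sets borel" and "A \<in> sets borel"
  shows "emeasure (distr \<mu> borel f) A = emeasure \<mu> (f -` A)"
  using emeasure_image_kernel[OF h, of "\<lambda>_. \<mu>"] assms by (simp add: image_kernel_apply[OF h])

section \<open>Irreducibility and aperiodicity\<close>

lemma irreducibility_measure_distr:
  assumes h: "homeomorphism UNIV UNIV f g" and P: "transition_kernel P"
    and \<mu>: "irreducibility_measure P \<mu>"
  shows "irreducibility_measure (image_kernel f P) (distr \<mu> borel f)"
proof -
  have s: "sets \<mu> = sets borel" and pos: "emeasure \<mu> UNIV > 0"
    and irr: "\<And>A y. A \<in> sets borel \<Longrightarrow> emeasure \<mu> A > 0 \<Longrightarrow> \<exists>k\<ge>1. emeasure (kernel_pow P k y) A > 0"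
    using \<mu> by (auto simp: irreducibility_measure_def)
  have "emeasure (distr \<mu> borel f) UNIV > 0"
    using pos by (simp add: emeasure_distr_homeomorphism[OF h s])
  moreover have "\<exists>k\<ge>1. emeasure (kernel_pow (image_kernel f P) k x) A > 0"
    if "A \<in> sets borel" "emeasure (distr \<mu> borel f) A > 0" for A x
    using irr[of "f -` A" "g x"] that
    by (simp add: kernel_pow_image_kernel[OF h P] emeasure_image_kernel[OF h sets_kernel_pow[OF P]]
        emeasure_distr_homeomorphism[OF h s] vimage_borel[OF h])
  ultimately show ?thesis
    by (simp add: irreducibility_measure_def)
qed

lemma irreducible_kernel_image_kernel:
  assumes "homeomorphism UNIV UNIV f g" and "transition_kernel P" and "irreducible_kernel P"
  shows "irreducible_kernel (image_kernel f P)"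
  using assms irreducibility_measure_distr unfolding irreducible_kernel_def by blast

lemma has_cycle_image_kernel:
  assumes h: "homeomorphism UNIV UNIV f g" and P: "transition_kernel P" and "has_cycle P k"
  shows "has_cycle (image_kernel f P) k"
proof -
  note h' = homeomorphism_symD[OF h]
  obtain D where D: "\<And>i. i < k \<Longrightarrow> D i \<in> sets borel" "disjoint_family_on D {..<k}"
    and null: "\<And>\<mu>. irreducibility_measure P \<mu> \<Longrightarrow> emeasure \<mu> (- (\<Union>i<k. D i)) = 0"
    and step: "\<And>i y. i < k \<Longrightarrow> y \<in> D i \<Longrightarrow> emeasure (P y) (D (Suc i mod k)) = 1"
    using assms(3) unfolding has_cycle_def by blast
  \<comment> \<open>The null condition concerns every irreducibility measure of the image kernel; each one is
    pulled back along \<open>g\<close> to an irreducibility measure of \<open>P\<close>.\<close>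
  have null': "emeasure \<mu> (- (\<Union>i<k. g -` D i)) = 0"
    if \<mu>: "irreducibility_measure (image_kernel f P) \<mu>" for \<mu>
  proof -
    have s: "sets \<mu> = sets borel"
      using \<mu> by (simp add: irreducibility_measure_def)
    have "irreducibility_measure P (distr \<mu> borel g)"
      using irreducibility_measure_distr[OF h' transition_kernel_image_kernel[OF h P] \<mu>]
      by (simp add: image_kernel_inverse[OF h sets_transition_kernel[OF P]])
    then have "emeasure (distr \<mu> borel g) (- (\<Union>i<k. D i)) = 0"
      by (rule null)
    moreover have "- (\<Union>i<k. D i) \<in> sets borel"
      using D(1) by (intro borel_comp sets.finite_UN) auto
    ultimately have "emeasure \<mu> (g -` (- (\<Union>i<k. D i))) = 0"
      by (simp add: emeasure_distr_homeomorphism[OF h' s])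
    also have "g -` (- (\<Union>i<k. D i)) = - (\<Union>i<k. g -` D i)"
      by auto
    finally show ?thesis .
  qed
  have step': "emeasure (image_kernel f P x) (g -` D (Suc i mod k)) = 1"
    if i: "i < k" and x: "x \<in> g -` D i" for i x
  proof -
    have "Suc i mod k < k"
      using i by simp
    then have "emeasure (image_kernel f P x) (g -` D (Suc i mod k))
        = emeasure (P (g x)) (f -` g -` D (Suc i mod k))"
      by (intro emeasure_image_kernel[OF h] sets_transition_kernel[OF P] vimage_borel[OF h'] D(1))
    also have "f -` g -` D (Suc i mod k) = D (Suc i mod k)"
      by (auto simp: homeomorphism_UNIV_inverse[OF h])
    finally show ?thesis
      using step[OF i] x by simp
  qed
  have "disjoint_family_on (\<lambda>i. g -` D i) {..<k}"
    using D(2) by (fastforce simp: disjoint_family_on_def)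
  then show ?thesis
    unfolding has_cycle_def using D(1) null' step' vimage_borel[OF h']
    by (intro exI[of _ "\<lambda>i. g -` D i"]) auto
qed

text \<open>
  Both directions are needed for the period: one transports a cycle of maximal length, the other
  shows that the image kernel has no longer cycle.
\<close>

lemma has_cycle_image_kernel_iff:
  assumes h: "homeomorphism UNIV UNIV f g" and P: "transition_kernel P"
  shows "has_cycle (image_kernel f P) k \<longleftrightarrow> has_cycle P k"
  using has_cycle_image_kernel[OF h P, of k]
    has_cycle_image_kernel[OF homeomorphism_symD[OF h] transition_kernel_image_kernel[OF h P], of k]
  by (auto simp: image_kernel_inverse[OF h sets_transition_kernel[OF P]])

lemma aperiodic_kernel_image_kernel:
  assumes "homeomorphism UNIV UNIV f g" and "transition_kernel P" and "aperiodic_kernel P"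
  shows "aperiodic_kernel (image_kernel f P)"
  using assms irreducible_kernel_image_kernel
  by (auto simp: aperiodic_kernel_def is_period_def has_cycle_image_kernel_iff)

section \<open>T-kernels\<close>

lemma T_kernel_image_kernel:
  assumes h: "homeomorphism UNIV UNIV f g" and P: "transition_kernel P" and "T_kernel P"
  shows "T_kernel (image_kernel f P)"
proof -
  obtain b :: "nat pmf" and T where T: "substochastic_kernel T"
    and lsc: "\<And>A. A \<in> sets borel \<Longrightarrow> lower_semicontinuous (\<lambda>y. emeasure (T y) A)"
    and pos: "\<And>y. emeasure (T y) UNIV > 0"
    and le: "\<And>y A. A \<in> sets borel \<Longrightarrow>
      emeasure (T y) A \<le> (\<Sum>k. ennreal (pmf b k) * emeasure (kernel_pow P k y) A)"
    using assms(3) unfolding T_kernel_def by blast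
  have s: "sets (T y) = sets borel" for y
    using measurable_space[OF T[unfolded substochastic_kernel_def], of y]
    by (simp add: space_subprob_algebra)
  note em = emeasure_image_kernel[OF h s] emeasure_image_kernel[OF h sets_kernel_pow[OF P]]
  have g: "continuous_on UNIV g"
    using h by (simp add: homeomorphism_def)
  have "lower_semicontinuous (\<lambda>x. emeasure (image_kernel f T x) A)" if A: "A \<in> sets borel" for A
    unfolding lower_semicontinuous_def
  proof
    fix c
    have "open (g -` {y. c < emeasure (T y) (f -` A)})"
      using lsc[OF vimage_borel[OF h A]]
      by (intro open_vimage g) (simp add: lower_semicontinuous_def)
    then show "open {x. c < emeasure (image_kernel f T x) A}"
      by (simp add: em A vimage_def)
  qed
  moreover have "emeasure (image_kernel f T x) UNIV > 0" for x
    using pos by (simp add: em)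
  moreover have "emeasure (image_kernel f T x) A
      \<le> (\<Sum>k. ennreal (pmf b k) * emeasure (kernel_pow (image_kernel f P) k x) A)"
    if "A \<in> sets borel" for x A
    using le[OF vimage_borel[OF h that], of "g x"] that
    by (simp add: em kernel_pow_image_kernel[OF h P])
  ultimately show ?thesis
    unfolding T_kernel_def using substochastic_kernel_image_kernel[OF h T] by blast
qed

section \<open>Markov chains\<close>

text \<open>
  The inclusion of the history of \<open>X\<close> in that of \<open>f \<circ> X\<close> uses that \<open>g\<close> is Borel; for a merely
  measurable \<open>f\<close> the history may shrink and the Markov property may be lost.
\<close>

lemma history_homeomorphism:
  assumes h: "homeomorphism UNIV UNIV f g"
  shows "history M (\<lambda>t \<omega>. f (X t \<omega>)) t = history M X t"
proof -
  have "{(\<lambda>\<omega>. f (X s \<omega>)) -` A \<inter> space M | s A. s \<le> t \<and> A \<in> sets borel}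
      = {X s -` B \<inter> space M | s B. s \<le> t \<and> B \<in> sets borel}" (is "?L = ?R")
  proof (intro equalityI subsetI)
    fix E assume "E \<in> ?L"
    then obtain s A where "E = (\<lambda>\<omega>. f (X s \<omega>)) -` A \<inter> space M" "s \<le> t" "A \<in> sets borel"
      by blast
    then have "E = X s -` (f -` A) \<inter> space M" "s \<le> t" "f -` A \<in> sets borel"
      using vimage_borel[OF h] by auto
    then show "E \<in> ?R" by blast
  next
    fix E assume "E \<in> ?R"
    then obtain s B where "E = X s -` B \<inter> space M" "s \<le> t" "B \<in> sets borel"
      by blast
    then have "E = (\<lambda>\<omega>. f (X s \<omega>)) -` (g -` B) \<inter> space M" "s \<le> t" "g -` B \<in> sets borel"
      using vimage_borel[OF homeomorphism_symD[OF h]]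
      by (auto simp: homeomorphism_UNIV_inverse[OF h])
    then show "E \<in> ?L" by blast
  qed
  then show ?thesis
    by (simp add: history_def)
qed

lemma markov_chain_homeomorphism:
  assumes h: "homeomorphism UNIV UNIV f g" and X: "markov_chain M X P"
  shows "markov_chain M (\<lambda>t \<omega>. f (X t \<omega>)) (image_kernel f P)"
proof -
  have P: "transition_kernel P" and meas: "\<And>t. X t \<in> M \<rightarrow>\<^sub>M borel"
    and markov: "\<And>t A. A \<in> sets borel \<Longrightarrow> AE \<omega> in M.
        real_cond_exp M (history M X t) (\<lambda>\<omega>'. indicator A (X (Suc t) \<omega>')) \<omega>
          = measure (P (X t \<omega>)) A"
    using X by (auto simp: markov_chain_def)
  have "AE \<omega> in M.
      real_cond_exp M (history M (\<lambda>t \<omega>. f (X t \<omega>)) t) (\<lambda>\<omega>'. indicator A (f (X (Suc t) \<omega>'))) \<omega>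
        = measure (image_kernel f P (f (X t \<omega>))) A" if A: "A \<in> sets borel" for t A
  proof -
    have "measure (image_kernel f P (f y)) A = measure (P y) (f -` A)" for y
      using emeasure_image_kernel[where P = P and x = "f y", OF h sets_transition_kernel[OF P] A]
      by (simp add: measure_def homeomorphism_UNIV_inverse[OF h])
    moreover have "(indicator A (f y) :: real) = indicator (f -` A) y" for y
      by (simp add: indicator_def)
    ultimately show ?thesis
      using markov[OF vimage_borel[OF h A], of t] by (simp add: history_homeomorphism[OF h])
  qed
  moreover have "(\<lambda>\<omega>. f (X t \<omega>)) \<in> M \<rightarrow>\<^sub>M borel" for t
    by (rule measurable_compose[OF meas homeomorphism_UNIV_measurable(1)[OF h]])
  ultimately show ?thesis
    using X transition_kernel_image_kernel[OF h P] by (simp add: markov_chain_def)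
qed

section \<open>Homeomorphic images of Markov chains\<close>

theorem theorem4p3:
  fixes \<xi> :: "'y::topological_space \<Rightarrow> 'x::topological_space"
    and \<zeta> :: "'x \<Rightarrow> 'y"
    and M :: "'a measure"
    and \<phi> :: "nat \<Rightarrow> 'a \<Rightarrow> 'y"
    and P :: "'y \<Rightarrow> 'y measure"
  assumes "homeomorphism UNIV UNIV \<xi> \<zeta>"
    and "markov_chain M \<phi> P"
  shows
    "markov_chain M (\<lambda>t \<omega>. \<xi> (\<phi> t \<omega>)) (image_kernel \<xi> P) \<and>
     (irreducible_kernel (image_kernel \<xi> P) \<longrightarrow> irreducible_kernel P) \<and>
     (aperiodic_kernel (image_kernel \<xi> P) \<longrightarrow> aperiodic_kernel P) \<and>
     (T_kernel (image_kernel \<xi> P) \<longrightarrow> T_kernel P) \<and>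
     (\<forall>Q. markov_chain M (\<lambda>t \<omega>. \<xi> (\<phi> t \<omega>)) Q \<longrightarrow>
        (\<exists>P'. markov_chain M \<phi> P' \<and>
           (irreducible_kernel Q \<longrightarrow> irreducible_kernel P') \<and>
           (aperiodic_kernel Q \<longrightarrow> aperiodic_kernel P') \<and>
           (T_kernel Q \<longrightarrow> T_kernel P')))"
proof -
  note h = assms(1) and chain = assms(2)
  note h' = homeomorphism_symD[OF h]
  have P: "transition_kernel P"
    using chain by (simp add: markov_chain_def)
  let ?Q = "image_kernel \<xi> P"
  have Q: "transition_kernel ?Q"
    by (rule transition_kernel_image_kernel[OF h P])
  have inverse: "image_kernel \<zeta> ?Q = P"
    by (rule image_kernel_inverse[OF h sets_transition_kernel[OF P]])
  have "\<exists>P'. markov_chain M \<phi> P' \<and>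
      (irreducible_kernel Q \<longrightarrow> irreducible_kernel P') \<and>
      (aperiodic_kernel Q \<longrightarrow> aperiodic_kernel P') \<and>
      (T_kernel Q \<longrightarrow> T_kernel P')"
    if mc: "markov_chain M (\<lambda>t \<omega>. \<xi> (\<phi> t \<omega>)) Q" for Q
  proof -
    have "transition_kernel Q"
      using mc by (simp add: markov_chain_def)
    moreover have "markov_chain M \<phi> (image_kernel \<zeta> Q)"
      using markov_chain_homeomorphism[OF h' mc] by (simp add: homeomorphism_UNIV_inverse[OF h])
    ultimately show ?thesis
      using irreducible_kernel_image_kernel[OF h'] aperiodic_kernel_image_kernel[OF h']
        T_kernel_image_kernel[OF h'] by blast
  qed
  then show ?thesis
    using markov_chain_homeomorphism[OF h chain] irreducible_kernel_image_kernel[OF h' Q]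
      aperiodic_kernel_image_kernel[OF h' Q] T_kernel_image_kernel[OF h' Q]
    unfolding inverse by blast
qed

end
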